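(* Let $\alpha>0$, let $\mu$ be a probability measure on a measurable space $\mathcal{X}$, and let $h:\mathcal{X}\to(0,\infty)^d$ and the open convex set $\Omega\subset\mathbb{R}^d$ be as in the context. Then the potential function $$\varphi(\xi)=-\log\int_{\mathcal{X}}(1+\alpha\,\xi\cdot h(x))^{-1/\alpha}\,d\mu(x),\qquad\xi\in\Omega,$$ of the $\mathcal{F}^{(\alpha)}$-family $p(x,\xi)=(1+\alpha\xi\cdot h(x))^{-1/\alpha}e^{\varphi(\xi)}$ is $\alpha$-exponentially concave on $\Omega$, i.e. $e^{\alpha\varphi}$ is concave on $\Omega$.
   Context: Standing assumptions: $h=(h^1,\dots,h^d)$ is measurable with positive components and such that $\xi\cdot h=\xi'\cdot h$ $\mu$-a.e. implies $\xi=\xi'$; for all $\xi\in\Omega$, $1+\alpha\xi\cdot h>0$ on $\mathcal{X}$, the integral defining $\varphi(\xi)$ is finite, and one can differentiate it with respect to $\xi$ under the integral sign (as many times as needed). *)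

theory Defs
  imports "HOL-Probability.Probability"
begin

definition partial_deriv :: "'n::finite \<Rightarrow> (real^'n \<Rightarrow> real) \<Rightarrow> real^'n \<Rightarrow> real"
  where "partial_deriv i f \<xi> = deriv (\<lambda>t. f (\<xi> + t *\<^sub>R axis i 1)) 0"

abbreviation iterated_partial :: "'n::finite list \<Rightarrow> (real^'n \<Rightarrow> real) \<Rightarrow> real^'n \<Rightarrow> real"
  where "iterated_partial I f \<equiv> foldr partial_deriv I f"

(* Partial derivatives of every order exist and may be taken under the integral sign on \<Omega>.
   Taking I = [] gives the first-order rule; by induction on I the I-th partial derivative of
   the integral is the integral of the I-th partial derivative. The differentiability clause
   for the integrand is needed because deriv is total. *)
definition differentiable_under_integral ::
    "'a measure \<Rightarrow> (real^'n::finite) set \<Rightarrow> (real^'n \<Rightarrow> 'a \<Rightarrow> real) \<Rightarrow> bool"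
  where "differentiable_under_integral M \<Omega> F \<longleftrightarrow>
    (\<forall>I. \<forall>\<xi>\<in>\<Omega>.
       integrable M (\<lambda>x. iterated_partial I (\<lambda>\<eta>. F \<eta> x) \<xi>) \<and>
       (\<forall>i.
         (\<forall>x\<in>space M.
            (\<lambda>t. iterated_partial I (\<lambda>\<eta>. F \<eta> x) (\<xi> + t *\<^sub>R axis i 1))
              field_differentiable (at 0)) \<and>
         ((\<lambda>t. \<integral>x. iterated_partial I (\<lambda>\<eta>. F \<eta> x) (\<xi> + t *\<^sub>R axis i 1) \<partial>M)
            has_real_derivative (\<integral>x. iterated_partial (i # I) (\<lambda>\<eta>. F \<eta> x) \<xi> \<partial>M)) (at 0)))"

definition F_kernel :: "real \<Rightarrow> ('a \<Rightarrow> real^'n::finite) \<Rightarrow> real^'n \<Rightarrow> 'a \<Rightarrow> real"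
  where "F_kernel \<alpha> h \<xi> x = (1 + \<alpha> * (\<xi> \<bullet> h x)) powr (- 1 / \<alpha>)"

definition F_potential :: "real \<Rightarrow> 'a measure \<Rightarrow> ('a \<Rightarrow> real^'n::finite) \<Rightarrow> real^'n \<Rightarrow> real"
  where "F_potential \<alpha> M h \<xi> = - ln (\<integral>x. F_kernel \<alpha> h \<xi> x \<partial>M)"

definition F_density :: "real \<Rightarrow> 'a measure \<Rightarrow> ('a \<Rightarrow> real^'n::finite) \<Rightarrow> 'a \<Rightarrow> real^'n \<Rightarrow> real"
  where "F_density \<alpha> M h x \<xi> = F_kernel \<alpha> h \<xi> x * exp (F_potential \<alpha> M h \<xi>)"

lemma integral_F_density:
  assumes "prob_space M"
    and "\<And>x. x \<in> space M \<Longrightarrow> 1 + \<alpha> * (\<xi> \<bullet> h x) > 0"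
    and int: "integrable M (F_kernel \<alpha> h \<xi>)"
  shows "(\<integral>x. F_density \<alpha> M h x \<xi> \<partial>M) = 1"
proof -
  interpret prob_space M by fact
  have "0 < (\<integral>x. F_kernel \<alpha> h \<xi> x \<partial>M)"
  proof -
    have pos: "AE x in M. 0 < F_kernel \<alpha> h \<xi> x"
      by (rule AE_I2) (use assms(2) in \<open>force simp: F_kernel_def\<close>)
    show ?thesis
      using integral_less_AE_space[of "\<lambda>_. 0" "F_kernel \<alpha> h \<xi>"] int pos
      by (simp add: emeasure_space_1)
  qed
  then show ?thesis
    by (simp add: F_density_def F_potential_def exp_minus)
qed

definition exponentially_concave_on :: "real \<Rightarrow> 'b::real_vector set \<Rightarrow> ('b \<Rightarrow> real) \<Rightarrow> bool"
  where "exponentially_concave_on \<alpha> \<Omega> \<phi> \<longleftrightarrow> concave_on \<Omega> (\<lambda>\<xi>. exp (\<alpha> * \<phi> \<xi>))"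

end

theory Submission
  imports Defs
begin

text \<open>
  With $p = -1/\alpha < 0$, the function $e^{\alpha\varphi}$ is the $p$-mean
  $(\int f^p\,d\mu)^{1/p}$ of $f = 1 + \alpha\,\xi\cdot h$, and $f$ is affine in $\xi$.
  So the claim is the reverse Minkowski inequality for a negative exponent, which after normalising
  the two means to 1 is the convexity of $t \mapsto t^p$ integrated over $\mathcal{X}$.
\<close>

lemma convex_on_powr_neg:
  fixes p :: real
  assumes "p < 0"
  shows "convex_on {0<..} (\<lambda>t. t powr p)"
proof (rule f''_ge0_imp_convex)
  fix t :: real
  assume t: "t \<in> {0<..}"
  show "((\<lambda>t. t powr p) has_real_derivative p * t powr (p - 1)) (at t)"
    using t by (auto intro!: derivative_eq_intros)
  show "((\<lambda>t. p * t powr (p - 1)) has_real_derivative p * ((p - 1) * t powr (p - 2))) (at t)"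
    using t by (auto intro!: derivative_eq_intros)
  \<comment> \<open>Both \<open>p\<close> and \<open>p - 1\<close> are negative, so their product is
    positive.\<close>
  show "0 \<le> p * ((p - 1) * t powr (p - 2))"
    using assms by (simp add: zero_le_mult_iff mult_le_0_iff)
qed auto

text \<open>Strictness survives integration because the whole space has measure 1. Logarithms and
  real powers of such integrals can then be inverted.\<close>

lemma (in prob_space) integral_powr_pos:
  assumes "\<And>x. x \<in> space M \<Longrightarrow> f x > (0::real)"
    and "integrable M (\<lambda>x. f x powr p)"
  shows "0 < (\<integral>x. f x powr p \<partial>M)"
proof -
  have "AE x in M. 0 < f x powr p"
    by (rule AE_I2) (use assms(1) in force)
  then show ?thesis
    using integral_less_AE_space[of "\<lambda>_. 0" "\<lambda>x. f x powr p"] assms(2)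
    by (simp add: emeasure_space_1)
qed

text \<open>The \<open>p\<close>-mean is homogeneous of degree one, so the scaling factors that
  normalise \<open>f\<close> and \<open>g\<close> can be absorbed into the weights. Keeping
  \<open>u\<close> and \<open>v\<close> in the statement covers a zero weight, where
  \<open>u * f x\<close> alone would not be positive.\<close>

lemma (in prob_space) reverse_minkowski_powr_neg:
  fixes p u v :: real
  assumes p: "p < 0" and u: "u \<ge> 0" and v: "v \<ge> 0" and uv: "u + v > 0"
    and f: "\<And>x. x \<in> space M \<Longrightarrow> f x > 0" and g: "\<And>x. x \<in> space M \<Longrightarrow> g x > 0"
    and int_f: "integrable M (\<lambda>x. f x powr p)"
    and int_g: "integrable M (\<lambda>x. g x powr p)"
    and int_fg: "integrable M (\<lambda>x. (u * f x + v * g x) powr p)"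
  shows "u * (\<integral>x. f x powr p \<partial>M) powr (1 / p) + v * (\<integral>x. g x powr p \<partial>M) powr (1 / p)
    \<le> (\<integral>x. (u * f x + v * g x) powr p \<partial>M) powr (1 / p)"
proof -
  define A where "A = (\<integral>x. f x powr p \<partial>M) powr (1 / p)"
  define B where "B = (\<integral>x. g x powr p \<partial>M) powr (1 / p)"
  define S where "S = u * A + v * B"
  have If: "0 < (\<integral>x. f x powr p \<partial>M)" and Ig: "0 < (\<integral>x. g x powr p \<partial>M)"
    using f g int_f int_g by (auto intro: integral_powr_pos)
  have fg: "0 < u * f x + v * g x" if "x \<in> space M" for x
    using f[OF that] g[OF that] u v uv
    by (smt (verit) mult_nonneg_nonneg mult_pos_pos)
  have A: "A > 0" and B: "B > 0"
    using If Ig by (auto simp: A_def B_def)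
  have S: "S > 0"
    using A B u v uv unfolding S_def by (smt (verit) mult_nonneg_nonneg mult_pos_pos)
  have Ap: "A powr p = (\<integral>x. f x powr p \<partial>M)" and Bp: "B powr p = (\<integral>x. g x powr p \<partial>M)"
    using If Ig p by (simp_all add: A_def B_def powr_powr)
  \<comment> \<open>These weights make \<open>(u * f x + v * g x) / S\<close> the convex combination
    of \<open>f x / A\<close> and \<open>g x / B\<close>.\<close>
  define a where "a = u * A / S"
  define b where "b = v * B / S"
  have ab: "a \<ge> 0" "b \<ge> 0" "a + b = 1"
    using u v A B S by (simp_all add: a_def b_def S_def flip: add_divide_distrib)
  have pointwise: "(u * f x + v * g x) powr p / S powr p
      \<le> a * (f x powr p / A powr p) + b * (g x powr p / B powr p)" if x: "x \<in> space M" for x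
  proof -
    have "(a *\<^sub>R (f x / A) + b *\<^sub>R (g x / B)) powr p
        \<le> a * (f x / A) powr p + b * (g x / B) powr p"
      using convex_on_powr_neg[OF p] ab f[OF x] g[OF x] A B
      unfolding convex_on_def by (simp del: times_divide_eq_right)
    moreover have "a *\<^sub>R (f x / A) + b *\<^sub>R (g x / B) = (u * f x + v * g x) / S"
      using A B S by (simp add: a_def b_def add_divide_distrib)
    ultimately show ?thesis
      using f[OF x] g[OF x] fg[OF x] A B S by (simp add: powr_divide)
  qed
  have "(\<integral>x. (u * f x + v * g x) powr p / S powr p \<partial>M)
      \<le> (\<integral>x. a * (f x powr p / A powr p) + b * (g x powr p / B powr p) \<partial>M)"
    using pointwise int_f int_g int_fg by (intro integral_mono) auto
  \<comment> \<open>By \<open>Ap\<close> and \<open>Bp\<close> the normalised functions have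
    \<open>p\<close>-th powers of integral 1, so only \<open>a + b\<close> remains.\<close>
  also have "\<dots> = a * (A powr p / A powr p) + b * (B powr p / B powr p)"
    using int_f int_g by (simp add: Ap Bp)
  also have "\<dots> = 1"
    using A B ab by simp
  finally have "(\<integral>x. (u * f x + v * g x) powr p \<partial>M) \<le> S powr p"
    using S by (simp add: divide_le_eq)
  \<comment> \<open>The exponent \<open>1 / p\<close> is negative, so taking this power reverses the
    inequality; the smaller base must be positive for this.\<close>
  then have "(S powr p) powr (1 / p) \<le> (\<integral>x. (u * f x + v * g x) powr p \<partial>M) powr (1 / p)"
    using p fg int_fg by (intro powr_mono2' integral_powr_pos) auto
  then show ?thesis
    using p S by (simp add: powr_powr S_def A_def B_def)
qed

theorem proposition2:
  fixes \<alpha> :: real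
    and M :: "'a measure"
    and h :: "'a \<Rightarrow> real^'d::finite"
    and \<Omega> :: "(real^'d) set"
  assumes "\<alpha> > 0"
    and "prob_space M"
    and "h \<in> borel_measurable M"
    and "\<And>x i. x \<in> space M \<Longrightarrow> h x $ i > 0"
    and "\<And>\<xi> \<xi>'. (AE x in M. \<xi> \<bullet> h x = \<xi>' \<bullet> h x) \<Longrightarrow> \<xi> = \<xi>'"
    and "open \<Omega>"
    and "convex \<Omega>"
    and "\<And>\<xi> x. \<xi> \<in> \<Omega> \<Longrightarrow> x \<in> space M \<Longrightarrow> 1 + \<alpha> * (\<xi> \<bullet> h x) > 0"
    and "\<And>\<xi>. \<xi> \<in> \<Omega> \<Longrightarrow> integrable M (F_kernel \<alpha> h \<xi>)"
    and "differentiable_under_integral M \<Omega> (F_kernel \<alpha> h)"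
  shows "exponentially_concave_on \<alpha> \<Omega> (F_potential \<alpha> M h)"
proof -
  interpret prob_space M by fact
  define p where "p = - 1 / \<alpha>"
  define L where "L \<xi> x = 1 + \<alpha> * (\<xi> \<bullet> h x)" for \<xi> x
  have p: "p < 0" "1 / p = - \<alpha>"
    using \<open>\<alpha> > 0\<close> by (simp_all add: p_def)
  have kernel: "F_kernel \<alpha> h \<xi> = (\<lambda>x. L \<xi> x powr p)" for \<xi>
    by (simp add: F_kernel_def L_def p_def fun_eq_iff)
  have L_pos: "L \<xi> x > 0" if "\<xi> \<in> \<Omega>" "x \<in> space M" for \<xi> x
    using assms(8) that by (simp add: L_def)
  have int: "integrable M (\<lambda>x. L \<xi> x powr p)" if "\<xi> \<in> \<Omega>" for \<xi>
    using assms(9)[OF that] by (simp add: kernel)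
  \<comment> \<open>For an integral \<open>I > 0\<close>, exp(- \<alpha> ln I) is the power of
    \<open>I\<close> with exponent - \<alpha>, which is \<open>1 / p\<close>.\<close>
  have mean: "exp (\<alpha> * F_potential \<alpha> M h \<xi>) = (\<integral>x. L \<xi> x powr p \<partial>M) powr (1 / p)"
    if "\<xi> \<in> \<Omega>" for \<xi>
    using integral_powr_pos[OF L_pos int, OF that _ that] p
    by (simp add: F_potential_def kernel powr_def)
  \<comment> \<open>The constant term 1 of \<open>L\<close> splits as \<open>u + v\<close>.\<close>
  have L_affine: "L (u *\<^sub>R \<xi> + v *\<^sub>R \<eta>) x = u * L \<xi> x + v * L \<eta> x" if "u + v = 1" for u v \<xi> \<eta> x
  proof -
    have "u * L \<xi> x + v * L \<eta> x = (u + v) + \<alpha> * (u * (\<xi> \<bullet> h x) + v * (\<eta> \<bullet> h x))"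
      by (simp add: L_def algebra_simps)
    then show ?thesis
      using that by (simp add: L_def inner_add_left)
  qed
  show ?thesis
    unfolding exponentially_concave_on_def concave_on_iff
  proof (intro conjI ballI allI impI)
    show "convex \<Omega>" by fact
    fix \<xi> \<eta> :: "real^'d" and u v :: real
    assume \<xi>: "\<xi> \<in> \<Omega>" and \<eta>: "\<eta> \<in> \<Omega>" and uv: "u \<ge> 0" "v \<ge> 0" "u + v = 1"
    \<comment> \<open>Convexity of \<Omega> brings the mixed point under \<open>int\<close>, giving
      the integrability of the combined power.\<close>
    have mix: "u *\<^sub>R \<xi> + v *\<^sub>R \<eta> \<in> \<Omega>"
      using \<open>convex \<Omega>\<close> \<xi> \<eta> uv by (simp add: convexD)
    show "exp (\<alpha> * F_potential \<alpha> M h (u *\<^sub>R \<xi> + v *\<^sub>R \<eta>))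
        \<ge> u * exp (\<alpha> * F_potential \<alpha> M h \<xi>) + v * exp (\<alpha> * F_potential \<alpha> M h \<eta>)"
      unfolding mean[OF \<xi>] mean[OF \<eta>] mean[OF mix] L_affine[OF uv(3)]
      using p uv L_pos \<xi> \<eta> int int[OF mix]
      by (intro reverse_minkowski_powr_neg) (auto simp: L_affine)
  qed
qed

end
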